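(* For every irrational $\alpha\in\mathbb{T}$ there exists a continuous function $\varphi:\mathbb{T}\to\mathbb{R}$ with zero mean ($\int_{\mathbb{T}}\varphi\,dx=0$) such that the set $D^{s_-s_+}(\alpha,\varphi)$ is uncountable for every $s_-,s_+\in\{-,+\}$.
   Context: $\mathbb{T}=\mathbb{R}/\mathbb{Z}$. For $n\in\mathbb{Z}$: $\varphi^{(n)}(x)=\sum_{k=0}^{n-1}\varphi(x+k\alpha)$ for $n>0$, $\varphi^{(0)}=0$, $\varphi^{(n)}(x)=-\sum_{k=1}^{|n|}\varphi(x-k\alpha)$ for $n<0$. For $s_-,s_+\in\{-,+\}$, $D^{s_-s_+}(\alpha,\varphi)=\{x\in\mathbb{T}:\ \varphi^{(m)}(x)\to s_-\infty \text{ as } m\to-\infty \text{ and } \varphi^{(m)}(x)\to s_+\infty\text{ as }m\to+\infty\}$. *)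

theory Defs
  imports "HOL-Analysis.Analysis"
begin

section \<open>The circle group\<close>

quotient_type circle = real / "\<lambda>x y. x - y \<in> \<int>"
  morphisms rep_circle to_circle
proof (rule equivpI)
  show "reflp (\<lambda>x y :: real. x - y \<in> \<int>)"
    by (simp add: reflp_def)
  show "symp (\<lambda>x y :: real. x - y \<in> \<int>)"
  proof (rule sympI)
    fix x y :: real
    assume "x - y \<in> \<int>"
    from Ints_minus [OF this] show "y - x \<in> \<int>" by simp
  qed
  show "transp (\<lambda>x y :: real. x - y \<in> \<int>)"
  proof (rule transpI)
    fix x y z :: real
    assume "x - y \<in> \<int>" "y - z \<in> \<int>"
    from Ints_add [OF this] show "x - z \<in> \<int>" by simp
  qed
qed

instantiation circle :: ab_group_add
begin

lift_definition zero_circle :: circle is 0 .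

lift_definition plus_circle :: "circle \<Rightarrow> circle \<Rightarrow> circle" is "(+)"
proof -
  fix a b c d :: real
  assume "a - b \<in> \<int>" "c - d \<in> \<int>"
  from Ints_add [OF this] show "a + c - (b + d) \<in> \<int>"
    by (simp add: algebra_simps)
qed

lift_definition uminus_circle :: "circle \<Rightarrow> circle" is uminus
proof -
  fix a b :: real
  assume "a - b \<in> \<int>"
  from Ints_minus [OF this] show "- a - - b \<in> \<int>"
    by simp
qed

lift_definition minus_circle :: "circle \<Rightarrow> circle \<Rightarrow> circle" is "(-)"
proof -
  fix a b c d :: real
  assume "a - b \<in> \<int>" "c - d \<in> \<int>"
  from Ints_diff [OF this] show "a - c - (b - d) \<in> \<int>"
    by (simp add: algebra_simps)
qed

instance
  by standard (transfer; simp)+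

end

text \<open>The quotient topology with respect to the projection from the real line.\<close>

instantiation circle :: topological_space
begin

definition open_circle :: "circle set \<Rightarrow> bool" where
  "open_circle U \<longleftrightarrow> open (to_circle -` U)"

instance
proof
  show "open (UNIV :: circle set)"
    by (simp add: open_circle_def)
  show "open (S \<inter> T)" if "open S" "open T" for S T :: "circle set"
    using that by (simp add: open_circle_def vimage_Int open_Int)
  show "open (\<Union>K)" if "\<forall>S\<in>K. open S" for K :: "circle set set"
    using that by (auto simp: open_circle_def vimage_Union)
qed

end

lemma continuous_on_to_circle: "continuous_on A to_circle"
proof (rule continuous_on_subset)
  show "continuous_on UNIV to_circle"
    by (simp add: continuous_on_open_vimage open_circle_def)
qed simp

lift_definition circle_mult :: "nat \<Rightarrow> circle \<Rightarrow> circle" is "\<lambda>k x. of_nat k * x"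
proof -
  fix k :: nat and x y :: real
  assume "x - y \<in> \<int>"
  from Ints_mult [OF Ints_of_nat [of k] this] show "of_nat k * x - of_nat k * y \<in> \<int>"
    by (simp add: right_diff_distrib)
qed

lemma circle_mult_0: "circle_mult 0 a = 0"
  by transfer simp

lemma circle_mult_Suc: "circle_mult (Suc k) a = a + circle_mult k a"
  by transfer (simp add: algebra_simps)

lift_definition circle_irrational :: "circle \<Rightarrow> bool" is "\<lambda>x. x \<notin> \<rat>"
proof -
  fix x y :: real
  assume "x - y \<in> \<int>"
  then have xy: "x - y \<in> \<rat>"
    using Ints_subset_Rats by blast
  then show "(x \<notin> \<rat>) = (y \<notin> \<rat>)"
    using Rats_add [OF xy, of y] Rats_diff [OF _ xy, of x] by auto
qed

text \<open>Normalised Haar measure, as the image of Lebesgue measure on a fundamental domain.\<close>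

definition circle_measure :: "circle measure" where
  "circle_measure = distr (restrict_space lborel {0..<1}) borel to_circle"

lemma measurable_to_circle: "to_circle \<in> restrict_space lborel {0..<1} \<rightarrow>\<^sub>M borel"
proof -
  have "to_circle \<in> lborel \<rightarrow>\<^sub>M borel"
    using borel_measurable_continuous_onI [OF continuous_on_to_circle] by simp
  then show ?thesis
    by (rule measurable_restrict_space1)
qed

lemma integral_circle_measure:
  fixes f :: "circle \<Rightarrow> real"
  assumes "continuous_on UNIV f"
  shows "integral\<^sup>L circle_measure f = (LINT t:{0..<1}|lborel. f (to_circle t))"
proof -
  have "f \<in> borel_measurable borel"
    using assms by (rule borel_measurable_continuous_onI)
  then show ?thesis
    unfolding circle_measure_def set_lebesgue_integral_def
    by (simp add: integral_distr measurable_to_circle integral_restrict_space)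
qed

section \<open>Birkhoff sums and divergence sets\<close>

definition birkhoff_sum :: "circle \<Rightarrow> (circle \<Rightarrow> real) \<Rightarrow> int \<Rightarrow> circle \<Rightarrow> real" where
  "birkhoff_sum \<alpha> \<phi> n x =
    (if n > 0 then \<Sum>k = 0..<nat n. \<phi> (x + circle_mult k \<alpha>)
     else if n = 0 then 0
     else - (\<Sum>k = 1..nat \<bar>n\<bar>. \<phi> (x - circle_mult k \<alpha>)))"

datatype sign = Minus | Plus

fun signed_infinity :: "sign \<Rightarrow> real filter" where
  "signed_infinity Minus = at_bot"
| "signed_infinity Plus = at_top"

definition divergence_set :: "sign \<Rightarrow> sign \<Rightarrow> circle \<Rightarrow> (circle \<Rightarrow> real) \<Rightarrow> circle set" where
  "divergence_set s_minus s_plus \<alpha> \<phi> =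
    {x. filterlim (\<lambda>m. birkhoff_sum \<alpha> \<phi> m x) (signed_infinity s_minus) at_bot \<and>
        filterlim (\<lambda>m. birkhoff_sum \<alpha> \<phi> m x) (signed_infinity s_plus) at_top}"

end

theory Submission
  imports Defs
begin

text \<open>
  The function is a uniformly convergent series of coboundaries
  \<open>\<phi> = (\<Sum>n. g n \<circ> T - g n)\<close>, where \<open>T\<close> is the rotation; so it is continuous with mean zero, and its
  Birkhoff sums are \<open>\<Sum>n. g n (T^m x) - g n x\<close>. The points \<open>x\<close> form a Cantor set of subset sums
  \<open>\<Sum>k\<in>B. \<delta> k\<close>, with \<open>\<delta>\<close> decreasing rapidly and chosen so that all finite subset sums lie on distinct
  orbits. Hence, at stage \<open>n\<close>, small neighbourhoods of the \<open>2^n\<close> partial sums have disjoint translates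
  up to any prescribed time, and \<open>g n\<close> can be prescribed along them: it vanishes at time \<open>0\<close>, moves in
  steps of size at most \<open>2^-n\<close> with the desired sign, and stays at height \<open>4^n\<close> for
  \<open>8^n \<le> \<bar>m\<bar> \<le> 8^(n+1)\<close>. In this window the earlier \<open>g k\<close> are uncontrolled but add up to at most
  \<open>4^n - 2^n\<close>, and the later ones still have the right sign.
\<close>

section \<open>Distance to the nearest integer\<close>

definition dist_int :: "real \<Rightarrow> real" where
  "dist_int t = infdist t \<int>"

lemma dist_int_le: "k \<in> \<int> \<Longrightarrow> dist_int t \<le> \<bar>t - k\<bar>"
  unfolding dist_int_def by (metis dist_real_def infdist_le)

lemma dist_int_attained:
  obtains k where "k \<in> \<int>" "dist_int t = \<bar>t - k\<bar>"
  using infdist_attains_inf [of "\<int> :: real set" t] closed_Ints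
  unfolding dist_int_def dist_real_def by (metis Ints_0 empty_iff)

lemma dist_int_nonneg: "0 \<le> dist_int t"
  by (simp add: dist_int_def infdist_nonneg)

lemma dist_int_pos: "t \<notin> \<int> \<Longrightarrow> 0 < dist_int t"
  by (metis dist_int_attained dist_int_nonneg abs_le_zero_iff eq_iff_diff_eq_0 not_le)

lemma dist_int_diff_le: "dist_int (x - y) \<le> dist_int x + dist_int y"
proof -
  obtain k l where "k \<in> \<int>" "l \<in> \<int>" "dist_int x = \<bar>x - k\<bar>" "dist_int y = \<bar>y - l\<bar>"
    by (metis dist_int_attained)
  then show ?thesis
    using dist_int_le [of "k - l" "x - y"] by simp
qed

lemma dist_int_add_one: "dist_int (t + 1) = dist_int t"
proof (rule antisym)
  obtain k where "k \<in> \<int>" "dist_int t = \<bar>t - k\<bar>" by (rule dist_int_attained)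
  then show "dist_int (t + 1) \<le> dist_int t"
    using dist_int_le [of "k + 1" "t + 1"] by simp
next
  obtain k where "k \<in> \<int>" "dist_int (t + 1) = \<bar>t + 1 - k\<bar>" by (rule dist_int_attained)
  then show "dist_int t \<le> dist_int (t + 1)"
    using dist_int_le [of "k - 1" t] by (simp add: algebra_simps)
qed

lemma continuous_on_dist_int:
  "continuous_on A f \<Longrightarrow> continuous_on A (\<lambda>x. dist_int (f x))"
  unfolding dist_int_def by (rule continuous_on_infdist)

text \<open>For \<open>0 < r\<close>, a trapezoid of period \<open>1\<close>: value \<open>1\<close>
  up to distance \<open>r\<close> from the integers, \<open>0\<close> from distance
  \<open>2 * r\<close> on. The plateau allows values to be prescribed on whole neighbourhoods and
  not only at points.\<close>

definition bump :: "real \<Rightarrow> real \<Rightarrow> real" where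
  "bump r t = max 0 (min 1 (2 - dist_int t / r))"

lemma bump_range: "0 \<le> bump r t" "bump r t \<le> 1"
  by (auto simp: bump_def)

lemma bump_eq_1: "0 < r \<Longrightarrow> \<bar>t\<bar> \<le> r \<Longrightarrow> bump r t = 1"
  using dist_int_le [of 0 t] by (simp add: bump_def min_def field_simps)

lemma bump_support: "0 < r \<Longrightarrow> bump r t \<noteq> 0 \<Longrightarrow> dist_int t < 2 * r"
  by (simp add: bump_def max_def min_def field_simps split: if_splits)

section \<open>Functions prescribed along finitely many orbit segments\<close>

text \<open>At most one summand is nonzero, so the number of terms does not enter the bound. It
  serves both for the size of a combination of disjoint bumps and for its increments along the
  rotation.\<close>

lemma abs_sum_single_support_le:
  fixes u v :: "'p \<Rightarrow> real"
  assumes "0 \<le> h" and v: "\<And>p. p \<in> P \<Longrightarrow> \<bar>v p\<bar> \<le> h"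
    and u: "\<And>p. 0 \<le> u p" "\<And>p. u p \<le> 1"
    and single: "\<And>p q. p \<in> P \<Longrightarrow> q \<in> P \<Longrightarrow> u p \<noteq> 0 \<Longrightarrow> u q \<noteq> 0 \<Longrightarrow> p = q"
  shows "\<bar>\<Sum>p\<in>P. v p * u p\<bar> \<le> h"
proof (cases "\<exists>p\<in>P. u p \<noteq> 0 \<and> finite P")
  case True
  then obtain p where p: "p \<in> P" "u p \<noteq> 0" "finite P" by blast
  have "(\<Sum>q\<in>P. v q * u q) = (\<Sum>q\<in>{p}. v q * u q)"
    using p single by (intro sum.mono_neutral_right) auto
  moreover have "\<bar>v p * u p\<bar> \<le> h * 1"
    unfolding abs_mult using v [OF p(1)] u [of p] \<open>0 \<le> h\<close> by (intro mult_mono) auto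
  ultimately show ?thesis by simp
next
  case False
  \<comment> \<open>Infinite \<open>P\<close> falls into this case, since its sum is
    \<open>0\<close> by convention.\<close>
  then have "(\<Sum>q\<in>P. v q * u q) = 0"
    by (cases "finite P") (auto intro: sum.neutral)
  with \<open>0 \<le> h\<close> show ?thesis by simp
qed

text \<open>Reindexing moves the window by one; since \<open>w\<close> vanishes at
  \<open>-L\<close>, at \<open>L\<close> and beyond, the terms gained and lost at the ends are
  \<open>0\<close>.\<close>

lemma sum_int_shift:
  fixes w u :: "int \<Rightarrow> real"
  assumes w: "\<And>m. L \<le> \<bar>m\<bar> \<Longrightarrow> w m = 0"
  shows "(\<Sum>m\<in>{-L..L}. w m * u (m - 1)) = (\<Sum>m\<in>{-L..L}. w (m + 1) * u m)"
proof -
  have "(\<Sum>m\<in>{-L..L}. w m * u (m - 1)) = (\<Sum>m\<in>{-L-1..L-1}. w (m + 1) * u m)"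
    by (rule sum.reindex_bij_witness [of _ "\<lambda>m. m + 1" "\<lambda>m. m - 1"]) auto
  also have "\<dots> = (\<Sum>m\<in>{-L-1..L}. w (m + 1) * u m)"
    by (rule sum.mono_neutral_left) (auto intro!: w)
  also have "\<dots> = (\<Sum>m\<in>{-L..L}. w (m + 1) * u m)"
    by (rule sum.mono_neutral_right) (auto intro!: w)
  finally show ?thesis .
qed

lemma finite_lower_bound:
  fixes f :: "'p \<Rightarrow> real"
  assumes "finite P" "\<And>p. p \<in> P \<Longrightarrow> 0 < f p"
  obtains e where "0 < e" "\<And>p. p \<in> P \<Longrightarrow> e \<le> f p"
proof
  show "0 < Min (insert 1 (f ` P))" using assms by (subst Min_gr_iff) auto
  show "Min (insert 1 (f ` P)) \<le> f p" if "p \<in> P" for p using assms that by auto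
qed

text \<open>The points \<open>c i + m * a\<close> with \<open>\<bar>m\<bar> \<le> L\<close> are
  distinct modulo \<open>1\<close>, so narrow bumps around them have disjoint supports, and
  \<open>g\<close> is the sum of these bumps with coefficients \<open>w i m\<close>. Translation by
  \<open>a\<close> carries each bump to its neighbour on the orbit, so
  \<open>g (t + a) - g t\<close> is a sum of the same bumps with coefficients
  \<open>w i (m + 1) - w i m\<close>; no bump is lost at the ends because \<open>w\<close> vanishes
  there.\<close>

lemma tower_function_exists:
  fixes c :: "'i \<Rightarrow> real" and w :: "'i \<Rightarrow> int \<Rightarrow> real" and a :: real
  assumes fin: "finite I"
    and generic: "\<And>i j m. i \<in> I \<Longrightarrow> j \<in> I \<Longrightarrow> i \<noteq> j \<or> m \<noteq> 0 \<Longrightarrow> c i - c j + of_int m * a \<notin> \<int>"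
    and w_support: "\<And>i m. i \<in> I \<Longrightarrow> L \<le> \<bar>m\<bar> \<Longrightarrow> w i m = 0"
    and w_bound: "\<And>i m. i \<in> I \<Longrightarrow> \<bar>w i m\<bar> \<le> h"
    and w_slope: "\<And>i m. i \<in> I \<Longrightarrow> \<bar>w i (m + 1) - w i m\<bar> \<le> \<epsilon>"
    and "0 \<le> h" "0 \<le> \<epsilon>" "0 \<le> L"
  obtains r g where "0 < r" "continuous_on UNIV g" "\<And>t. g (t + 1) = g t"
    "\<And>t. \<bar>g t\<bar> \<le> h" "\<And>t. \<bar>g (t + a) - g t\<bar> \<le> \<epsilon>"
    "\<And>i t m. i \<in> I \<Longrightarrow> \<bar>t - c i\<bar> \<le> r \<Longrightarrow> \<bar>m\<bar> \<le> L \<Longrightarrow> g (t + of_int m * a) = w i m"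
    "\<And>i j. i \<in> I \<Longrightarrow> j \<in> I \<Longrightarrow> i \<noteq> j \<Longrightarrow> 2 * r < dist_int (c i - c j)"
proof -
  define P where "P = I \<times> {-L..L}"
  define q where "q p = c (fst p) + of_int (snd p) * a" for p
  have finP: "finite P" using fin by (simp add: P_def)
  have q_diff: "q p - q p' = c (fst p) - c (fst p') + of_int (snd p - snd p') * a" for p p'
    by (simp add: q_def algebra_simps)
  have "0 < dist_int (q p - q p')" if "p \<in> P" "p' \<in> P" "p \<noteq> p'" for p p'
    unfolding q_diff using that by (intro dist_int_pos generic) (auto simp: P_def prod_eq_iff)
  then have pos: "0 < dist_int (q (fst x) - q (snd x))" if "x \<in> P \<times> P - Id" for x
    using that by (cases x) fastforce
  have "finite (P \<times> P - Id)" using finP by simp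
  then obtain e where "0 < e" and e_le: "\<And>x. x \<in> P \<times> P - Id \<Longrightarrow> e \<le> dist_int (q (fst x) - q (snd x))"
    using finite_lower_bound [of "P \<times> P - Id" "\<lambda>x. dist_int (q (fst x) - q (snd x))"] pos by metis
  have e: "e \<le> dist_int (q p - q p')" if "p \<in> P" "p' \<in> P" "p \<noteq> p'" for p p'
    using e_le [of "(p, p')"] that by simp
  \<comment> \<open>Two bumps that are nonzero at a common point have centres less than
    \<open>4 * r = e\<close> apart, which \<open>e\<close> forbids; also \<open>2 * r < e\<close>
    separates the centres \<open>c i\<close>.\<close>
  define r where "r = e / 4"
  have r: "0 < r" using \<open>0 < e\<close> by (simp add: r_def)
  have single: "p = p'" if "p \<in> P" "p' \<in> P" "bump r (t - q p) \<noteq> 0" "bump r (t - q p') \<noteq> 0" for p p' t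
  proof (rule ccontr)
    assume "p \<noteq> p'"
    then have "e \<le> dist_int ((t - q p') - (t - q p))" using e that by simp
    also have "\<dots> \<le> dist_int (t - q p') + dist_int (t - q p)" by (rule dist_int_diff_le)
    also have "\<dots> < 4 * r" using bump_support [OF r that(3)] bump_support [OF r that(4)] by simp
    finally show False by (simp add: r_def)
  qed
  define g where "g t = (\<Sum>p\<in>P. w (fst p) (snd p) * bump r (t - q p))" for t
  have g_double: "g t = (\<Sum>i\<in>I. \<Sum>m\<in>{-L..L}. w i m * bump r (t - q (i, m)))" for t
    unfolding g_def P_def by (simp add: sum.cartesian_product case_prod_beta)
  show thesis
  proof
    show "0 < r" by fact
    show "continuous_on UNIV g"
      unfolding g_def bump_def using r by (intro continuous_intros continuous_on_dist_int) auto
    show "g (t + 1) = g t" for t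
      unfolding g_def bump_def using dist_int_add_one [of "t - q p" for p]
      by (simp add: algebra_simps)
    show "\<bar>g t\<bar> \<le> h" for t
      unfolding g_def using single \<open>0 \<le> h\<close> w_bound
      by (intro abs_sum_single_support_le) (auto simp: P_def bump_range)
    show "\<bar>g (t + a) - g t\<bar> \<le> \<epsilon>" for t
    proof -
      have "g (t + a) = (\<Sum>i\<in>I. \<Sum>m\<in>{-L..L}. w i m * bump r (t - q (i, m - 1)))"
        unfolding g_double by (simp add: q_def algebra_simps)
      also have "\<dots> = (\<Sum>i\<in>I. \<Sum>m\<in>{-L..L}. w i (m + 1) * bump r (t - q (i, m)))"
        by (intro sum.cong sum_int_shift [where u = "\<lambda>m. bump r (t - q (i, m))" for i]) (auto intro: w_support)
      finally have "g (t + a) - g t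
          = (\<Sum>i\<in>I. \<Sum>m\<in>{-L..L}. (w i (m + 1) - w i m) * bump r (t - q (i, m)))"
        unfolding g_double by (simp add: sum_subtractf left_diff_distrib)
      also have "\<dots> = (\<Sum>p\<in>P. (w (fst p) (snd p + 1) - w (fst p) (snd p)) * bump r (t - q p))"
        unfolding P_def by (simp add: sum.cartesian_product case_prod_beta)
      also have "\<bar>\<dots>\<bar> \<le> \<epsilon>"
        using single \<open>0 \<le> \<epsilon>\<close> w_slope
        by (intro abs_sum_single_support_le) (auto simp: P_def bump_range)
      finally show ?thesis .
    qed
    show "g (t + of_int m * a) = w i m" if "i \<in> I" "\<bar>t - c i\<bar> \<le> r" "\<bar>m\<bar> \<le> L" for i t m
    proof -
      have im: "(i, m) \<in> P" using that by (auto simp: P_def)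
      have one: "bump r (t + of_int m * a - q (i, m)) = 1"
        using that by (intro bump_eq_1 r) (simp add: q_def)
      then have "g (t + of_int m * a) = (\<Sum>p\<in>{(i, m)}. w (fst p) (snd p) * bump r (t + of_int m * a - q p))"
        unfolding g_def using single [OF im, of _ "t + of_int m * a"] im finP
        by (intro sum.mono_neutral_right) fastforce+
      then show ?thesis using one by simp
    qed
    show "2 * r < dist_int (c i - c j)" if "i \<in> I" "j \<in> I" "i \<noteq> j" for i j
      using e [of "(i, 0)" "(j, 0)"] that \<open>0 \<le> L\<close> \<open>0 < e\<close> by (simp add: P_def q_def r_def)
  qed
qed

section \<open>The stages of the construction\<close>

definition sgn_of :: "bool \<Rightarrow> real" where
  "sgn_of p = (if p then 1 else - 1)"

text \<open>Rises from \<open>0\<close> with slope \<open>2^-n\<close>, equals \<open>4^n\<close> on \<open>[8^n, 8^(n+1)]\<close>, and is back at \<open>0\<close> from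
  \<open>9 * 8^n\<close> on.\<close>

definition ramp :: "nat \<Rightarrow> real \<Rightarrow> real" where
  "ramp n y = max 0 (min (min (y / 2 ^ n) (4 ^ n)) (9 * 4 ^ n - y / 2 ^ n))"

lemma ramp_range: "0 \<le> ramp n y" "ramp n y \<le> 4 ^ n"
  by (auto simp: ramp_def min_le_iff_disj)

lemma ramp_zero: "ramp n 0 = 0"
  by (simp add: ramp_def)

text \<open>The time scale \<open>8 ^ n\<close> is the time needed to reach height
  \<open>4 ^ n\<close> with slope \<open>1 / 2 ^ n\<close>.\<close>

lemma power_8: "(8 :: real) ^ n = 4 ^ n * 2 ^ n"
  by (simp flip: power_mult_distrib)

lemma ramp_plateau: "8 ^ n \<le> y \<Longrightarrow> y \<le> 8 ^ Suc n \<Longrightarrow> ramp n y = 4 ^ n"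
proof -
  assume "8 ^ n \<le> y" "y \<le> 8 ^ Suc n"
  then have "4 ^ n \<le> y / 2 ^ n" "4 ^ n \<le> 9 * 4 ^ n - y / 2 ^ n"
    unfolding power_Suc power_8 by (simp_all add: field_simps)
  then show ?thesis by (simp add: ramp_def)
qed

lemma ramp_support: "9 * 8 ^ n \<le> y \<Longrightarrow> ramp n y = 0"
proof -
  assume "9 * 8 ^ n \<le> y"
  then have "9 * 4 ^ n - y / 2 ^ n \<le> 0"
    unfolding power_8 by (simp add: field_simps)
  then show ?thesis by (simp add: ramp_def)
qed

lemma ramp_slope: "\<bar>y - z\<bar> \<le> 1 \<Longrightarrow> \<bar>ramp n y - ramp n z\<bar> \<le> 1 / 2 ^ n"
proof -
  assume "\<bar>y - z\<bar> \<le> 1"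
  then have "\<bar>y / 2 ^ n - z / 2 ^ n\<bar> \<le> 1 / 2 ^ n"
    unfolding diff_divide_distrib [symmetric] abs_divide by (simp add: divide_right_mono)
  moreover have min: "\<bar>min p q - min p' q'\<bar> \<le> e" if "\<bar>p - p'\<bar> \<le> e" "\<bar>q - q'\<bar> \<le> e" for p q p' q' e :: real
    using that by linarith
  moreover have max: "\<bar>max 0 p - max 0 p'\<bar> \<le> e" if "\<bar>p - p'\<bar> \<le> e" for p p' e :: real
    using that by linarith
  ultimately show ?thesis
    unfolding ramp_def by (intro max min) (simp_all add: abs_minus_commute)
qed

text \<open>The first two elements of the index set encode the signs: \<open>0 \<in> B\<close> the one for negative times,
  \<open>1 \<in> B\<close> the one for nonnegative times.\<close>

definition weight :: "nat \<Rightarrow> nat set \<Rightarrow> int \<Rightarrow> real" where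
  "weight n B m = sgn_of (if m < 0 then 0 \<in> B else 1 \<in> B) * ramp n \<bar>of_int m\<bar>"

lemma weight_bound: "\<bar>weight n B m\<bar> \<le> 4 ^ n"
  using ramp_range [of n] by (simp add: weight_def abs_mult sgn_of_def)

lemma weight_support: "9 * 8 ^ n \<le> \<bar>m\<bar> \<Longrightarrow> weight n B m = 0"
proof -
  assume "9 * 8 ^ n \<le> \<bar>m\<bar>"
  then have "real_of_int (9 * 8 ^ n) \<le> of_int \<bar>m\<bar>" by (simp only: of_int_le_iff)
  then show ?thesis by (simp add: weight_def ramp_support)
qed

text \<open>Only the step from \<open>-1\<close> to \<open>0\<close> can change the sign, and it is
  harmless because \<open>ramp n\<close> vanishes at \<open>0\<close>; every other step compares two
  values of one ramp with a common sign.\<close>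

lemma weight_slope: "\<bar>weight n B (m + 1) - weight n B m\<bar> \<le> 1 / 2 ^ n"
proof (cases "m = - 1")
  case True
  then show ?thesis using ramp_slope [of 1 0 n] by (simp add: ramp_zero weight_def sgn_of_def abs_mult)
next
  case False
  then have "(m + 1 < 0) = (m < 0)" by auto
  then have "\<bar>weight n B (m + 1) - weight n B m\<bar> = \<bar>ramp n \<bar>of_int (m + 1)\<bar> - ramp n \<bar>of_int m\<bar>\<bar>"
    by (auto simp: weight_def sgn_of_def)
  also have "\<dots> \<le> 1 / 2 ^ n" by (rule ramp_slope) simp
  finally show ?thesis .
qed

text \<open>The instances with \<open>B = B'\<close> amount to the irrationality of
  \<open>a\<close>; the others put the \<open>2 ^ n\<close> subset sums on pairwise distinct orbits,
  as \<open>tower_function_exists\<close> requires.\<close>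

definition generic :: "real \<Rightarrow> nat \<Rightarrow> (nat \<Rightarrow> real) \<Rightarrow> bool" where
  "generic a n \<delta> \<longleftrightarrow> (\<forall>B \<subseteq> {..<n}. \<forall>B' \<subseteq> {..<n}. \<forall>m :: int.
     B \<noteq> B' \<or> m \<noteq> 0 \<longrightarrow> sum \<delta> B - sum \<delta> B' + of_int m * a \<notin> \<int>)"

text \<open>The time bound \<open>9 * 8 ^ n\<close> is where the ramp is back at \<open>0\<close>.
  The last clause keeps the \<open>r\<close>-neighbourhoods of different subset sums apart modulo
  \<open>1\<close>; it later makes the coding of the Cantor set injective.\<close>

definition stage :: "real \<Rightarrow> nat \<Rightarrow> (nat \<Rightarrow> real) \<Rightarrow> real \<Rightarrow> (real \<Rightarrow> real) \<Rightarrow> bool" where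
  "stage a n \<delta> r g \<longleftrightarrow> 0 < r \<and> continuous_on UNIV g \<and> (\<forall>t. g (t + 1) = g t) \<and>
     (\<forall>t. \<bar>g t\<bar> \<le> 4 ^ n) \<and> (\<forall>t. \<bar>g (t + a) - g t\<bar> \<le> 1 / 2 ^ n) \<and>
     (\<forall>B \<subseteq> {..<n}. \<forall>t m. \<bar>t - sum \<delta> B\<bar> \<le> r \<longrightarrow> \<bar>m\<bar> \<le> 9 * 8 ^ n \<longrightarrow>
        g (t + of_int m * a) = weight n B m) \<and>
     (\<forall>B \<subseteq> {..<n}. \<forall>B' \<subseteq> {..<n}. B \<noteq> B' \<longrightarrow> 2 * r < dist_int (sum \<delta> B - sum \<delta> B'))"

lemma generic_cong: "(\<And>k. k < n \<Longrightarrow> \<delta> k = \<delta>' k) \<Longrightarrow> generic a n \<delta> = generic a n \<delta>'"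
proof -
  assume "\<And>k. k < n \<Longrightarrow> \<delta> k = \<delta>' k"
  then have "sum \<delta> B = sum \<delta>' B" if "B \<subseteq> {..<n}" for B
    using that by (intro sum.cong) auto
  then show ?thesis unfolding generic_def by simp
qed

lemma stage_cong: "(\<And>k. k < n \<Longrightarrow> \<delta> k = \<delta>' k) \<Longrightarrow> stage a n \<delta> r g = stage a n \<delta>' r g"
proof -
  assume "\<And>k. k < n \<Longrightarrow> \<delta> k = \<delta>' k"
  then have "sum \<delta> B = sum \<delta>' B" if "B \<subseteq> {..<n}" for B
    using that by (intro sum.cong) auto
  then show ?thesis unfolding stage_def by simp
qed

lemma stage_value:
  assumes "stage a n \<delta> r g" "B \<subseteq> {..<n}" "\<bar>t - sum \<delta> B\<bar> \<le> r" "\<bar>m\<bar> \<le> 9 * 8 ^ n"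
  shows "g (t + of_int m * a) = weight n B m"
  using assms by (simp add: stage_def)

lemma stage_separated:
  assumes "stage a n \<delta> r g" "B \<subseteq> {..<n}" "B' \<subseteq> {..<n}" "B \<noteq> B'"
  shows "2 * r < dist_int (sum \<delta> B - sum \<delta> B')"
  using assms by (simp add: stage_def)

lemma stage_exists:
  assumes "generic a n \<delta>" "0 < R"
  obtains r g where "stage a n \<delta> r g" "r \<le> R"
proof -
  obtain r g where *: "0 < r" "continuous_on UNIV g" "\<And>t. g (t + 1) = g t"
    "\<And>t. \<bar>g t\<bar> \<le> 4 ^ n" "\<And>t. \<bar>g (t + a) - g t\<bar> \<le> 1 / 2 ^ n"
    "\<And>B t m. B \<in> Pow {..<n} \<Longrightarrow> \<bar>t - sum \<delta> B\<bar> \<le> r \<Longrightarrow> \<bar>m\<bar> \<le> 9 * 8 ^ n \<Longrightarrow>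
      g (t + of_int m * a) = weight n B m"
    "\<And>B B'. B \<in> Pow {..<n} \<Longrightarrow> B' \<in> Pow {..<n} \<Longrightarrow> B \<noteq> B' \<Longrightarrow> 2 * r < dist_int (sum \<delta> B - sum \<delta> B')"
  proof (rule tower_function_exists [where I = "Pow {..<n}" and c = "sum \<delta>" and w = "weight n"
        and a = a and L = "9 * 8 ^ n" and h = "4 ^ n" and \<epsilon> = "1 / 2 ^ n"])
    show "sum \<delta> B - sum \<delta> B' + of_int m * a \<notin> \<int>"
      if "B \<in> Pow {..<n}" "B' \<in> Pow {..<n}" "B \<noteq> B' \<or> m \<noteq> 0" for B B' m
      using assms that unfolding generic_def by blast
  qed (rule weight_support weight_bound weight_slope that | assumption | simp)+
  \<comment> \<open>Each clause that mentions the radius survives a decrease to a smaller positive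
    value, so \<open>g\<close> can be kept.\<close>
  then have "stage a n \<delta> (min r R) g"
    unfolding stage_def
  proof (intro conjI allI impI)
    show "2 * min r R < dist_int (sum \<delta> B - sum \<delta> B')"
      if "B \<subseteq> {..<n}" "B' \<subseteq> {..<n}" "B \<noteq> B'" for B B'
      using *(7) [of B B'] that by simp
    show "g (t + of_int m * a) = weight n B m"
      if "B \<subseteq> {..<n}" "\<bar>t - sum \<delta> B\<bar> \<le> min r R" "\<bar>m\<bar> \<le> 9 * 8 ^ n" for B t m
      by (rule *(6)) (use that in simp_all)
    show "0 < min r R" using *(1) assms(2) by simp
  qed (rule *(2-5))+
  then show ?thesis using that by auto
qed

text \<open>If \<open>n\<close> lies in both index sets or in neither, \<open>d\<close> cancels and
  the hypothesis applies. Otherwise a violation expresses \<open>d\<close> through two integers and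
  two subsets of \<open>{..<n}\<close>, so only countably many \<open>d\<close> are excluded from an
  uncountable interval.\<close>

lemma generic_extend:
  assumes "generic a n \<delta>" "0 < R"
  obtains d where "0 < d" "d < R" "generic a (Suc n) (\<delta>(n := d))"
proof -
  define bad where "bad = (\<lambda>(k, m, B, B'). of_int k + of_int m * a + (sum \<delta> B - sum \<delta> B')) `
      (UNIV \<times> UNIV \<times> Pow {..<n} \<times> Pow {..<n} :: (int \<times> int \<times> nat set \<times> nat set) set)"
  have "countable bad"
    unfolding bad_def by (intro countable_image countable_SIGMA countableI_type countable_finite) auto
  then have "\<not> {0<..<R} \<subseteq> bad"
    using countable_subset uncountable_open_interval [of 0 R] assms(2) by blast
  then obtain d where d: "0 < d" "d < R" "d \<notin> bad"
    unfolding subset_iff greaterThanLessThan_iff by blast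
  have not_bad: "d \<noteq> of_int k + of_int m * a + (sum \<delta> B - sum \<delta> B')"
    if "B \<subseteq> {..<n}" "B' \<subseteq> {..<n}" for k m B B'
  proof
    assume "d = of_int k + of_int m * a + (sum \<delta> B - sum \<delta> B')"
    then have "d \<in> bad"
      unfolding bad_def using that by (intro image_eqI [of _ _ "(k, m, B, B')"]) auto
    with d(3) show False by simp
  qed
  have split: "sum (\<delta>(n := d)) B = sum \<delta> (B - {n}) + (if n \<in> B then d else 0)"
    if "B \<subseteq> {..<Suc n}" for B
  proof -
    have "finite B" using that finite_subset by blast
    moreover have "sum (\<delta>(n := d)) (B - {n}) = sum \<delta> (B - {n})" by (intro sum.cong) auto
    ultimately show ?thesis
      by (cases "n \<in> B") (auto simp: sum.remove)
  qed
  have "sum (\<delta>(n := d)) B - sum (\<delta>(n := d)) B' + of_int m * a \<notin> \<int>"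
    if B: "B \<subseteq> {..<Suc n}" "B' \<subseteq> {..<Suc n}" and ne: "B \<noteq> B' \<or> m \<noteq> 0" for B B' and m :: int
  proof
    assume "sum (\<delta>(n := d)) B - sum (\<delta>(n := d)) B' + of_int m * a \<in> \<int>"
    then obtain k :: int where k: "sum (\<delta>(n := d)) B - sum (\<delta>(n := d)) B' + of_int m * a = of_int k"
      by (auto elim: Ints_cases)
    have sub: "B - {n} \<subseteq> {..<n}" "B' - {n} \<subseteq> {..<n}" using B by (auto simp: less_Suc_eq)
    consider "n \<in> B \<longleftrightarrow> n \<in> B'" | "n \<in> B" "n \<notin> B'" | "n \<notin> B" "n \<in> B'" by blast
    then show False
    proof cases
      case 1
      then have "B - {n} \<noteq> B' - {n} \<or> m \<noteq> 0" using ne by blast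
      then have "sum \<delta> (B - {n}) - sum \<delta> (B' - {n}) + of_int m * a \<notin> \<int>"
        using assms(1) sub unfolding generic_def by blast
      then show False using k 1 unfolding split [OF B(1)] split [OF B(2)]
        by (auto split: if_splits)
    next
      case 2
      then show False using k not_bad [OF sub(2,1), of k "- m"]
        unfolding split [OF B(1)] split [OF B(2)] by simp
    next
      case 3
      then show False using k not_bad [OF sub, of "- k" m]
        unfolding split [OF B(1)] split [OF B(2)] by simp
    qed
  qed
  then have "generic a (Suc n) (\<delta>(n := d))" unfolding generic_def by blast
  with d show ?thesis using that by blast
qed

text \<open>Dependent choice alternates between \<open>generic_extend\<close> and
  \<open>stage_exists\<close>: the radius \<open>r n\<close> is known before
  \<open>\<delta> n\<close> is chosen below half of it, and then the next function and radius
  follow. The halving ensures that all entries from \<open>\<delta> n\<close> on add up to at most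
  \<open>r n\<close>.\<close>

lemma stages_exist:
  assumes "a \<notin> \<rat>"
  obtains \<delta> r g where "\<And>n. stage a n \<delta> (r n) (g n)"
    "\<And>n. 0 < \<delta> n" "\<And>n. \<delta> n \<le> r n / 2" "\<And>n. r (Suc n) \<le> r n / 2"
proof -
  \<comment> \<open>A state carries a whole sequence, of which only the entries below
    \<open>n\<close> matter at stage \<open>n\<close>; \<open>Q\<close> freezes these and bounds the
    new entry and radius by the old radius.\<close>
  define Q where "Q = (\<lambda>(n :: nat) (\<delta> :: nat \<Rightarrow> real, r :: real, g :: real \<Rightarrow> real)
      (\<delta>' :: nat \<Rightarrow> real, r' :: real, g' :: real \<Rightarrow> real).
      (\<forall>k<n. \<delta>' k = \<delta> k) \<and> 0 < \<delta>' n \<and> \<delta>' n \<le> r / 2 \<and> r' \<le> r / 2)"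
  define P where "P = (\<lambda>n (\<delta>, r, g). generic a n \<delta> \<and> stage a n \<delta> r g)"
  have "\<exists>f. \<forall>n. P n (f n) \<and> Q n (f n) (f (Suc n))"
  proof (rule dependent_nat_choice)
    have "of_int m * a \<notin> \<int>" if "m \<noteq> 0" for m :: int
    proof
      assume "of_int m * a \<in> \<int>"
      then have "of_int m * a / of_int m \<in> \<rat>" using Ints_subset_Rats by (intro Rats_divide) auto
      with that assms show False by simp
    qed
    then have gen: "generic a 0 (\<lambda>_. 0)" by (auto simp: generic_def)
    obtain r g where "stage a 0 (\<lambda>_. 0) r g" by (rule stage_exists [OF gen zero_less_one])
    with gen show "\<exists>x. P 0 x" by (auto simp: P_def)
  next
    fix x n assume "P n x"
    then obtain \<delta> r g where x: "x = (\<delta>, r, g)" "generic a n \<delta>" "stage a n \<delta> r g"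
      by (auto simp: P_def)
    then have r: "0 < r / 2" by (simp add: stage_def)
    obtain d where d: "0 < d" "d < r / 2" "generic a (Suc n) (\<delta>(n := d))"
      using generic_extend [OF x(2) r] .
    obtain r' g' where "stage a (Suc n) (\<delta>(n := d)) r' g'" "r' \<le> r / 2"
      using stage_exists [OF d(3) r] .
    with d x(1) have "P (Suc n) (\<delta>(n := d), r', g') \<and> Q n x (\<delta>(n := d), r', g')"
      by (simp add: P_def Q_def)
    then show "\<exists>y. P (Suc n) y \<and> Q n x y" by blast
  qed
  then obtain f where f: "\<And>n. P n (f n)" "\<And>n. Q n (f n) (f (Suc n))" by blast
  define D where "D n = fst (f n)" for n
  define r where "r n = fst (snd (f n))" for n
  define g where "g n = snd (snd (f n))" for n
  have f_eq: "f n = (D n, r n, g n)" for n by (simp add: D_def r_def g_def)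
  have st: "stage a n (D n) (r n) (g n)" for n
    using f(1) [of n] by (simp add: P_def f_eq)
  have Q: "\<And>k. k < n \<Longrightarrow> D (Suc n) k = D n k" "0 < D (Suc n) n" "D (Suc n) n \<le> r n / 2" "r (Suc n) \<le> r n / 2" for n
    using f(2) [of n] by (simp_all add: Q_def f_eq)
  \<comment> \<open>An entry never changes once chosen, so the diagonal sequence agrees with
    \<open>D n\<close> below \<open>n\<close>, and \<open>stage_cong\<close> transfers every stage
    to it.\<close>
  have agree: "D n k = D (Suc k) k" if "k < n" for n k
    using that by (induction n) (auto simp: Q(1) less_Suc_eq)
  show thesis
  proof
    show "stage a n (\<lambda>k. D (Suc k) k) (r n) (g n)" for n
    proof -
      have "stage a n (D n) (r n) (g n) = stage a n (\<lambda>k. D (Suc k) k) (r n) (g n)"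
        by (rule stage_cong) (rule agree)
      then show ?thesis using st [of n] by simp
    qed
  qed (use Q in auto)
qed

section \<open>Series of coboundaries\<close>

lemma periodic_of_int:
  fixes f :: "real \<Rightarrow> 'b"
  assumes "\<And>t. f (t + 1) = f t"
  shows "f (t + of_int k) = f t"
proof -
  have nat: "f (t + of_nat n) = f t" for n t
  proof (induction n)
    case (Suc n)
    then show ?case using assms [of "t + of_nat n"] by (simp add: algebra_simps)
  qed simp
  show ?thesis
  proof (cases k rule: int_cases2)
    case (nonneg n)
    then show ?thesis using nat by simp
  next
    case (nonpos n)
    then show ?thesis using nat [of "t - of_nat n" n] by simp
  qed
qed

text \<open>The translated window \<open>{a..1 + a}\<close> is cut at \<open>1\<close>, and the
  piece beyond \<open>1\<close> is moved back by one period.\<close>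

lemma integral_periodic_shift:
  fixes g :: "real \<Rightarrow> real"
  assumes cont: "continuous_on UNIV g" and per: "\<And>t. g (t + 1) = g t" and "0 \<le> a" "a \<le> 1"
  shows "integral {0..1} (\<lambda>t. g (t + a)) = integral {0..1} g"
proof -
  have c: "continuous_on A g" for A using cont continuous_on_subset by blast
  then have int: "g integrable_on {x..y}" for x y by (rule integrable_continuous_real)
  have "integral {0..1} (\<lambda>t. g (t + a)) = integral {a..1 + a} g"
    using integral_shift [of 0 a 1 g] c by (simp add: o_def)
  also have "\<dots> = integral {a..1} g + integral {1..1 + a} g"
    using int assms by (intro Henstock_Kurzweil_Integration.integral_combine [symmetric]) auto
  also have "integral {1..1 + a} g = integral {0..a} g"
    using integral_shift [of 0 1 a g] c per by (simp add: o_def add.commute)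
  also have "integral {a..1} g + integral {0..a} g = integral {0..1} g"
    using int assms Henstock_Kurzweil_Integration.integral_combine [of 0 a 1 g] by simp
  finally show ?thesis .
qed

lemma continuous_on_circle_iff:
  fixes \<phi> :: "circle \<Rightarrow> 'b :: topological_space"
  shows "continuous_on UNIV \<phi> \<longleftrightarrow> continuous_on UNIV (\<lambda>t. \<phi> (to_circle t))"
  by (simp add: continuous_on_open_vimage open_circle_def vimage_def)

lemma integral_circle_measure_eq_integral:
  fixes \<phi> :: "circle \<Rightarrow> real"
  assumes "continuous_on UNIV \<phi>"
  shows "integral\<^sup>L circle_measure \<phi> = integral {0..1} (\<lambda>t. \<phi> (to_circle t))"
proof -
  let ?f = "\<lambda>t. \<phi> (to_circle t)"
  have "continuous_on {0..1} ?f"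
    using assms continuous_on_subset unfolding continuous_on_circle_iff by blast
  then have int: "set_integrable lborel {0..1} ?f"
    by (rule borel_integrable_atLeastAtMost')
  \<comment> \<open>The two domains differ only in the null set \<open>{1}\<close>.\<close>
  have "(LINT t:{0..<1}|lborel. ?f t) = (LINT t:{0..1}|lborel. ?f t)"
    unfolding set_lebesgue_integral_def
  proof (rule integral_cong_AE)
    show "AE t in lborel. indicat_real {0..<1} t *\<^sub>R ?f t = indicat_real {0..1} t *\<^sub>R ?f t"
      using AE_lborel_singleton [of 1] by eventually_elim (auto simp: indicator_def)
    have "set_integrable lborel {0..<1} ?f"
      by (rule set_integrable_subset [OF int]) auto
    then show "(\<lambda>t. indicat_real {0..<1} t *\<^sub>R ?f t) \<in> borel_measurable lborel"
      unfolding set_integrable_def by (rule borel_measurable_integrable)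
    show "(\<lambda>t. indicat_real {0..1} t *\<^sub>R ?f t) \<in> borel_measurable lborel"
      using int unfolding set_integrable_def by (rule borel_measurable_integrable)
  qed
  then show ?thesis
    using integral_circle_measure [OF assms] set_borel_integral_eq_integral(2) [OF int] by simp
qed

text \<open>The Weierstrass test gives uniform convergence, hence continuity and termwise
  integration, and each coboundary has mean zero by translation invariance. Only the increments need
  a summable bound; the series of the \<open>g n\<close> themselves may diverge.\<close>

lemma coboundary_series:
  fixes g :: "nat \<Rightarrow> real \<Rightarrow> real"
  assumes "0 \<le> a" "a \<le> 1" and cont: "\<And>n. continuous_on UNIV (g n)"
    and per: "\<And>n t. g n (t + 1) = g n t"
    and bound: "\<And>n t. \<bar>g n (t + a) - g n t\<bar> \<le> M n" and "summable M"
  obtains \<phi> :: "circle \<Rightarrow> real" where "continuous_on UNIV \<phi>" "integral\<^sup>L circle_measure \<phi> = 0"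
    "\<And>t. (\<lambda>n. g n (t + a) - g n t) sums \<phi> (to_circle t)"
proof -
  define f where "f n t = g n (t + a) - g n t" for n t
  define \<Phi> where "\<Phi> t = (\<Sum>n. f n t)" for t
  have sums: "(\<lambda>n. f n t) sums \<Phi> t" for t
    unfolding \<Phi>_def using bound
    by (intro summable_sums summable_comparison_test' [OF \<open>summable M\<close>]) (auto simp: f_def)
  have "f n (t + 1) = f n t" for n t
    using per [of n t] per [of n "t + a"] by (simp add: f_def algebra_simps)
  then have "\<Phi> (t + 1) = \<Phi> t" for t by (simp add: \<Phi>_def)
  then have \<Phi>_int: "\<Phi> (t + of_int k) = \<Phi> t" for t k by (rule periodic_of_int)
  \<comment> \<open>The choice of representative does not matter: two of them differ by an integer,
    and \<open>\<Phi>\<close> has period \<open>1\<close>.\<close>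
  define \<phi> where "\<phi> y = \<Phi> (rep_circle y)" for y
  have \<phi>: "\<phi> (to_circle t) = \<Phi> t" for t
  proof -
    have "to_circle (rep_circle (to_circle t)) = to_circle t"
      using Quotient_abs_rep [OF Quotient_circle] by blast
    then have "rep_circle (to_circle t) - t \<in> \<int>"
      by (simp add: circle.abs_eq_iff)
    then obtain k where "rep_circle (to_circle t) = t + of_int k"
      by (metis Ints_cases add.commute diff_add_cancel)
    then show ?thesis by (simp add: \<phi>_def \<Phi>_int)
  qed
  have unif: "uniform_limit A (\<lambda>n t. \<Sum>i<n. f i t) \<Phi> sequentially" for A
    unfolding \<Phi>_def using bound
    by (intro Weierstrass_m_test [OF _ \<open>summable M\<close>]) (auto simp: f_def)
  have cont_g: "continuous_on A (\<lambda>t. g n (t + s))" for A n s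
    by (rule continuous_on_compose2 [OF cont]) (auto intro!: continuous_intros)
  then have cont_f: "continuous_on A (f n)" for A n
    unfolding f_def using cont_g [of A n 0] by (intro continuous_intros) auto
  then have cont_sum: "continuous_on A (\<lambda>t. \<Sum>i<n. f i t)" for A n
    by (intro continuous_intros)
  have "continuous_on UNIV \<Phi>"
    by (rule uniform_limit_theorem [OF _ unif]) (use cont_sum in auto)
  then have cont_\<phi>: "continuous_on UNIV \<phi>" by (simp add: continuous_on_circle_iff \<phi>)
  obtain I J where I: "\<And>n. ((\<lambda>t. \<Sum>i<n. f i t) has_integral I n) {0..1}"
    and J: "(\<Phi> has_integral J) {0..1}" "I \<longlonglongrightarrow> J"
    by (rule uniform_limit_integral [OF unif cont_sum]) auto
  have "integral {0..1} (f n) = 0" for n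
  proof -
    have "integral {0..1} (f n) = integral {0..1} (\<lambda>t. g n (t + a)) - integral {0..1} (g n)"
      unfolding f_def using cont_g [of _ n a] cont_g [of _ n 0]
      by (intro Henstock_Kurzweil_Integration.integral_diff integrable_continuous_real) auto
    then show ?thesis using integral_periodic_shift [OF cont per] assms(1,2) by simp
  qed
  then have "(f n has_integral 0) {0..1}" for n
    using integrable_continuous_real [OF cont_f] by (metis integrable_integral)
  then have "((\<lambda>t. \<Sum>i<n. f i t) has_integral (\<Sum>i<n. 0)) {0..1}" for n
    by (intro has_integral_sum) auto
  then have "I n = 0" for n using has_integral_unique [OF I] by fastforce
  then have "I = (\<lambda>_. 0)" by auto
  then have "J = 0" using J(2) LIMSEQ_unique tendsto_const by blast
  then have "integral\<^sup>L circle_measure \<phi> = 0"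
    using integral_circle_measure_eq_integral [OF cont_\<phi>] J(1) by (simp add: \<phi> integral_unique)
  with that cont_\<phi> sums show ?thesis by (simp add: \<phi> f_def)
qed

text \<open>For each fixed \<open>n\<close> the sum along the orbit telescopes, and finitely many
  convergent series may be added termwise. The sign convention for negative times makes the same
  formula hold there.\<close>

lemma birkhoff_sum_coboundary_series:
  assumes \<phi>: "\<And>t. (\<lambda>n. g n (t + a) - g n t) sums \<phi> (to_circle t)"
  shows "(\<lambda>n. g n (t + of_int m * a) - g n t) sums birkhoff_sum (to_circle a) \<phi> m (to_circle t)"
proof -
  have forward: "(\<lambda>n. g n (t + of_nat N * a) - g n t) sums (\<Sum>k = 0..<N. \<phi> (to_circle (t + of_nat k * a)))" for N
  proof (induction N)
    case (Suc N)
    then show ?case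
      using sums_add [OF Suc \<phi> [of "t + of_nat N * a"]] by (simp add: algebra_simps)
  qed simp
  have backward: "(\<lambda>n. g n (t - of_nat N * a) - g n t) sums - (\<Sum>k = 1..N. \<phi> (to_circle (t - of_nat k * a)))" for N
  proof (induction N)
    case (Suc N)
    have "- (\<Sum>k = 1..Suc N. \<phi> (to_circle (t - of_nat k * a)))
        = - (\<Sum>k = 1..N. \<phi> (to_circle (t - of_nat k * a))) - \<phi> (to_circle (t - of_nat (Suc N) * a))"
      by simp
    moreover have "(\<lambda>n. g n (t - of_nat (Suc N) * a) - g n t) = (\<lambda>n. g n (t - of_nat N * a) - g n t -
        (g n (t - of_nat (Suc N) * a + a) - g n (t - of_nat (Suc N) * a)))"
      by (simp add: algebra_simps)
    ultimately show ?case
      using sums_diff [OF Suc \<phi> [of "t - of_nat (Suc N) * a"]] by (simp only:)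
  qed simp
  consider "0 < m" | "m = 0" | "m < 0" by linarith
  then show ?thesis
  proof cases
    case 1
    then show ?thesis using forward [of "nat m"]
      by (simp add: birkhoff_sum_def circle_mult.abs_eq plus_circle.abs_eq)
  next
    case 2
    then show ?thesis by (simp add: birkhoff_sum_def)
  next
    case 3
    then show ?thesis using backward [of "nat (- m)"]
      by (simp add: birkhoff_sum_def circle_mult.abs_eq minus_circle.abs_eq)
  qed
qed

section \<open>Divergence on a Cantor set\<close>

text \<open>The exact value is \<open>(4 ^ n - 1) / 3\<close>; this form leaves a margin of
  \<open>2 ^ n\<close> when the earlier stages are subtracted from a plateau of height
  \<open>4 ^ n\<close>.\<close>

lemma sum_power_4_le: "(\<Sum>k<n. 4 ^ k :: real) \<le> 4 ^ n - 2 ^ n"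
proof (induction n)
  case (Suc n)
  have "(2 :: real) ^ n \<le> 4 ^ n" by (rule power_mono) auto
  moreover have "(0 :: real) \<le> 4 ^ n" by simp
  ultimately show ?case using Suc unfolding power_Suc sum.lessThan_Suc by linarith
qed simp

text \<open>With \<open>n\<close> chosen so that
  \<open>8 ^ n \<le> \<bar>m\<bar> < 8 ^ Suc n\<close>, the signed term of index \<open>n\<close>
  equals \<open>4 ^ n\<close>, the later ones are nonnegative, and an earlier one of index
  \<open>k\<close> is at least \<open>- (4 ^ k)\<close>.\<close>

lemma stages_growth:
  assumes stage: "\<And>n. stage a n \<delta> (r n) (g n)"
    and near: "\<And>n. \<bar>t - sum \<delta> (B \<inter> {..<n})\<bar> \<le> r n"
    and sums: "(\<lambda>n. g n (t + of_int m * a) - g n t) sums S"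
    and "2 \<le> N" and m: "8 ^ N \<le> \<bar>m\<bar>"
  shows "2 ^ N \<le> sgn_of (if m < 0 then 0 \<in> B else 1 \<in> B) * S"
proof -
  define s where "s = sgn_of (if m < 0 then 0 \<in> B else 1 \<in> B)"
  define u where "u k = s * (g k (t + of_int m * a) - g k t)" for k
  have "1 \<le> nat \<bar>m\<bar>"
    using m one_le_power [of "8 :: int" N] by linarith
  then obtain n where "8 ^ n \<le> nat \<bar>m\<bar>" "nat \<bar>m\<bar> < 8 ^ Suc n"
    using ex_power_ivl1 [of 8 "nat \<bar>m\<bar>"] by auto
  then have "int (8 ^ n) \<le> int (nat \<bar>m\<bar>)" "int (nat \<bar>m\<bar>) < int (8 ^ Suc n)"
    by (simp_all only: of_nat_le_iff of_nat_less_iff)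
  then have n: "8 ^ n \<le> \<bar>m\<bar>" "\<bar>m\<bar> < 8 ^ Suc n"
    by simp_all
  have "(8 :: int) ^ N < 8 ^ Suc n"
    using m n(2) by linarith
  then have "N < Suc n"
    by (rule power_less_imp_less_exp [rotated]) simp
  then have "N \<le> n" by simp
  have "real_of_int (8 ^ n) \<le> of_int \<bar>m\<bar>" "real_of_int \<bar>m\<bar> \<le> of_int (8 ^ Suc n)"
    using n by (simp_all only: of_int_le_iff)
  then have ramp: "ramp n \<bar>of_int m\<bar> = 4 ^ n"
    by (intro ramp_plateau) simp_all
  have val: "g k (t + of_int i * a) = weight k (B \<inter> {..<k}) i" if "\<bar>i\<bar> \<le> 9 * 8 ^ k" for k i
    by (rule stage_value [OF stage _ near that]) simp
  have zero: "g k t = 0" for k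
    using val [of 0 k] by (simp add: weight_def ramp_zero)
  have late: "u k = ramp k \<bar>of_int m\<bar>" if "n \<le> k" for k
  proof -
    have "\<bar>m\<bar> \<le> 8 ^ Suc n" using n(2) by linarith
    also have "\<dots> \<le> 8 ^ Suc k" using that by (simp add: power_increasing)
    also have "\<dots> \<le> 9 * 8 ^ k" by simp
    finally have "u k = s * weight k (B \<inter> {..<k}) m" by (simp add: u_def val zero)
    \<comment> \<open>Here \<open>2 \<le> k\<close>, so \<open>0\<close> and \<open>1\<close> lie in
      \<open>{..<k}\<close> and the truncated set \<open>B \<inter> {..<k}\<close> still encodes
      both signs.\<close>
    then show ?thesis
      using that \<open>2 \<le> N\<close> \<open>N \<le> n\<close> by (simp add: s_def weight_def sgn_of_def)
  qed
  have early: "- (4 ^ k) \<le> u k" for k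
  proof -
    have "\<bar>u k\<bar> \<le> 4 ^ k"
      using stage [of k] by (simp add: u_def zero abs_mult s_def sgn_of_def stage_def)
    then show ?thesis by linarith
  qed
  \<comment> \<open>A termwise minorant of \<open>u\<close> with finitely many nonzero terms, so its
    series is a finite sum.\<close>
  define v :: "nat \<Rightarrow> real" where "v k = (if k < n then - (4 ^ k) else if k = n then 4 ^ n else 0)" for k
  have "v sums (\<Sum>k<Suc n. v k)" by (rule sums_finite) (auto simp: v_def)
  moreover have "(\<Sum>k<Suc n. v k) = 4 ^ n - (\<Sum>k<n. 4 ^ k)" by (simp add: v_def sum_negf)
  moreover have "u sums (s * S)" unfolding u_def by (rule sums_mult [OF sums])
  moreover have "v k \<le> u k" for k
    using early [of k] late [of k] ramp ramp_range [of k] by (simp add: v_def)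
  ultimately have "4 ^ n - (\<Sum>k<n. 4 ^ k) \<le> s * S" using sums_le [of v u] by simp
  moreover have "(2 :: real) ^ N \<le> 2 ^ n" using \<open>N \<le> n\<close> by (simp add: power_increasing)
  ultimately show ?thesis using sum_power_4_le [of n] unfolding s_def [symmetric] by linarith
qed

text \<open>The radii at least halve at each step, so the tail from index \<open>n\<close> on is
  dominated by the geometric series with terms \<open>r n / 2 * (1 / 2) ^ k\<close>, whose sum is
  exactly \<open>r n\<close>.\<close>

lemma subset_sums_near:
  fixes \<delta> r :: "nat \<Rightarrow> real"
  assumes \<delta>: "\<And>n. 0 < \<delta> n" "\<And>n. \<delta> n \<le> r n / 2" and r: "\<And>n. r (Suc n) \<le> r n / 2"
  shows "\<bar>(\<Sum>k. if k \<in> B then \<delta> k else 0) - sum \<delta> (B \<inter> {..<n})\<bar> \<le> r n"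
proof -
  define d where "d k = (if k \<in> B then \<delta> k else 0)" for k
  have r_le: "r (n + k) \<le> r n * (1 / 2) ^ k" for n k
  proof (induction k)
    case (Suc k)
    then show ?case using r [of "n + k"] by simp
  qed simp
  have d_le: "\<bar>d (k + n)\<bar> \<le> r n / 2 * (1 / 2) ^ k" for k n
    using \<delta> [of "k + n"] r_le [of n k] \<delta> [of n] by (auto simp: d_def add.commute)
  have geo: "(\<lambda>k. r n / 2 * (1 / 2) ^ k) sums r n" for n
    using sums_mult [OF geometric_sums [of "1 / 2 :: real"], of "r n / 2"] by simp
  have sum_d: "summable d"
    using summable_comparison_test' [OF sums_summable [OF geo [of 0]], of 0 d] d_le [of _ 0] by simp
  have "(\<Sum>k. d k) = (\<Sum>k. d (k + n)) + (\<Sum>k<n. d k)"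
    by (rule suminf_split_initial_segment [OF sum_d])
  moreover have "(\<Sum>k<n. d k) = sum \<delta> (B \<inter> {..<n})"
    by (simp add: d_def sum.inter_restrict [symmetric] Int_commute)
  moreover have "\<bar>\<Sum>k. d (k + n)\<bar> \<le> r n"
  proof -
    have "norm (\<Sum>k. d (k + n)) \<le> (\<Sum>k. r n / 2 * (1 / 2) ^ k)"
      using d_le by (intro norm_suminf_le sums_summable [OF geo]) simp
    then show ?thesis using sums_unique [OF geo [of n]] by simp
  qed
  ultimately show ?thesis by (simp add: d_def)
qed

text \<open>Dropping the two prescribed bits and shifting the rest by two maps this family onto all
  sets of natural numbers, so Cantor's theorem applies.\<close>

lemma uncountable_sets_with_prescribed_01:
  "uncountable {B :: nat set. (0 \<in> B \<longleftrightarrow> p) \<and> (1 \<in> B \<longleftrightarrow> q)}"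
proof
  let ?S = "{B :: nat set. (0 \<in> B \<longleftrightarrow> p) \<and> (1 \<in> B \<longleftrightarrow> q)}"
  assume "countable ?S"
  then have "countable ((\<lambda>B. {k. k + 2 \<in> B}) ` ?S)" by (rule countable_image)
  moreover have "A \<in> (\<lambda>B. {k. k + 2 \<in> B}) ` ?S" for A :: "nat set"
    by (rule image_eqI [of _ _ "{k. case k of 0 \<Rightarrow> p | Suc 0 \<Rightarrow> q | Suc (Suc j) \<Rightarrow> j \<in> A}"]) auto
  then have "(\<lambda>B. {k. k + 2 \<in> B}) ` ?S = UNIV" by blast
  ultimately have "countable (UNIV :: nat set set)" by simp
  then have "range (from_nat_into (UNIV :: nat set set)) = Pow UNIV"
    by (simp add: range_from_nat_into)
  then show False using Cantors_theorem by blast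
qed

theorem proposition6:
  fixes \<alpha> :: circle
  assumes "circle_irrational \<alpha>"
  shows "\<exists>\<phi> :: circle \<Rightarrow> real.
    continuous_on UNIV \<phi> \<and>
    integral\<^sup>L circle_measure \<phi> = 0 \<and>
    (\<forall>s_minus s_plus. uncountable (divergence_set s_minus s_plus \<alpha> \<phi>))"
proof -
  \<comment> \<open>The representative in the unit interval, as the shift of the integral in
    \<open>coboundary_series\<close> requires.\<close>
  define a where "a = frac (rep_circle \<alpha>)"
  have a01: "0 \<le> a" "a \<le> 1" using frac_lt_1 [of "rep_circle \<alpha>"] by (auto simp: a_def)
  have "to_circle (rep_circle \<alpha>) = \<alpha>" by (rule Quotient_abs_rep [OF Quotient_circle])
  moreover have "to_circle a = to_circle (rep_circle \<alpha>)"
    by (simp add: circle.abs_eq_iff a_def frac_def)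
  ultimately have \<alpha>: "\<alpha> = to_circle a" by simp
  with assms have "a \<notin> \<rat>" by (simp add: circle_irrational.abs_eq)
  then obtain \<delta> r g where stage: "\<And>n. stage a n \<delta> (r n) (g n)"
    and \<delta>: "\<And>n. 0 < \<delta> n" "\<And>n. \<delta> n \<le> r n / 2" and r: "\<And>n. r (Suc n) \<le> r n / 2"
    by (rule stages_exist) blast
  have "summable (\<lambda>n. 1 / 2 ^ n :: real)"
    using summable_geometric [of "1 / 2 :: real"] by (simp add: power_one_over)
  moreover have "continuous_on UNIV (g n)" "g n (t + 1) = g n t" "\<bar>g n (t + a) - g n t\<bar> \<le> 1 / 2 ^ n" for n t
    using stage [of n] by (simp_all add: stage_def)
  ultimately obtain \<phi> where \<phi>: "continuous_on UNIV \<phi>" "integral\<^sup>L circle_measure \<phi> = 0"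
    "\<And>t. (\<lambda>n. g n (t + a) - g n t) sums \<phi> (to_circle t)"
    using coboundary_series [OF a01, of g "\<lambda>n. 1 / 2 ^ n"] by blast
  \<comment> \<open>The Cantor set is coded by all sets of natural numbers: the bits
    \<open>0\<close> and \<open>1\<close> fix the two signs, the others are free.\<close>
  define x where "x B = (\<Sum>k. if k \<in> B then \<delta> k else 0)" for B
  have near: "\<bar>x B - sum \<delta> (B \<inter> {..<n})\<bar> \<le> r n" for B n
    unfolding x_def by (rule subset_sums_near [where \<delta> = \<delta> and r = r, OF \<delta> r])
  have inj: "inj (\<lambda>B. to_circle (x B))"
  proof (rule injI, rule ccontr)
    fix B B' assume eq: "to_circle (x B) = to_circle (x B')" and "B \<noteq> B'"
    then obtain k where "k \<in> B \<longleftrightarrow> k \<notin> B'" by blast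
    then have "B \<inter> {..<Suc k} \<noteq> B' \<inter> {..<Suc k}" by blast
    \<comment> \<open>The truncations are separated by more than \<open>2 * r (Suc k)\<close> modulo
      \<open>1\<close>, whereas each of the two points is within \<open>r (Suc k)\<close> of its
      truncation and \<open>x B - x B'\<close> is an integer.\<close>
    then have "2 * r (Suc k) < dist_int (sum \<delta> (B \<inter> {..<Suc k}) - sum \<delta> (B' \<inter> {..<Suc k}))"
      by (intro stage_separated [OF stage]) auto
    also have "\<dots> \<le> \<bar>sum \<delta> (B \<inter> {..<Suc k}) - sum \<delta> (B' \<inter> {..<Suc k}) - (x B - x B')\<bar>"
      using eq by (intro dist_int_le) (simp add: circle.abs_eq_iff)
    also have "\<dots> \<le> 2 * r (Suc k)"
      using near [of B "Suc k"] near [of B' "Suc k"] by linarith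
    finally show False by simp
  qed
  have growth: "2 ^ N \<le> sgn_of (if m < 0 then 0 \<in> B else 1 \<in> B) * birkhoff_sum \<alpha> \<phi> m (to_circle (x B))"
    if "2 \<le> N" "8 ^ N \<le> \<bar>m\<bar>" for B N and m :: int
    unfolding \<alpha> by (rule stages_growth [OF stage near birkhoff_sum_coboundary_series [OF \<phi>(3)] that])
  have large: "\<exists>N. 2 \<le> N \<and> Z \<le> 2 ^ N" for Z :: real
  proof -
    have "Z \<le> 2 ^ (nat \<lceil>Z\<rceil> + 2)"
      using of_nat_less_two_power [of "nat \<lceil>Z\<rceil> + 2", where 'a = real] by linarith
    then show ?thesis by (intro exI [of _ "nat \<lceil>Z\<rceil> + 2"]) simp
  qed
  have plus: "filterlim (\<lambda>m. sgn_of (1 \<in> B) * birkhoff_sum \<alpha> \<phi> m (to_circle (x B))) at_top at_top" for B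
    unfolding filterlim_at_top
  proof
    fix Z :: real
    obtain N where N: "2 \<le> N" "Z \<le> 2 ^ N" using large by blast
    show "\<forall>\<^sub>F m in at_top. Z \<le> sgn_of (1 \<in> B) * birkhoff_sum \<alpha> \<phi> m (to_circle (x B))"
      using eventually_ge_at_top [of "8 ^ N :: int"]
    proof eventually_elim
      case (elim m)
      moreover have "0 < (8 :: int) ^ N" by simp
      ultimately have "0 \<le> m" by linarith
      then show ?case using growth [of N m B] N elim by simp
    qed
  qed
  have minus: "filterlim (\<lambda>m. sgn_of (0 \<in> B) * birkhoff_sum \<alpha> \<phi> m (to_circle (x B))) at_top at_bot" for B
    unfolding filterlim_at_top
  proof
    fix Z :: real
    obtain N where N: "2 \<le> N" "Z \<le> 2 ^ N" using large by blast
    show "\<forall>\<^sub>F m in at_bot. Z \<le> sgn_of (0 \<in> B) * birkhoff_sum \<alpha> \<phi> m (to_circle (x B))"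
      using eventually_le_at_bot [of "- (8 ^ N) :: int"]
    proof eventually_elim
      case (elim m)
      moreover have "0 < (8 :: int) ^ N" by simp
      ultimately have "m < 0" "8 ^ N \<le> \<bar>m\<bar>" by linarith+
      then show ?case using growth [of N m B] N by simp
    qed
  qed
  have sign: "filterlim f (signed_infinity s) F"
    if "filterlim (\<lambda>m. sgn_of p * f m) at_top F" "p \<longleftrightarrow> s = Plus" for f :: "int \<Rightarrow> real" and s p F
    using that by (cases s) (auto simp: sgn_of_def filterlim_uminus_at_bot)
  have "uncountable (divergence_set s_minus s_plus \<alpha> \<phi>)" for s_minus s_plus
  proof
    let ?S = "{B :: nat set. (0 \<in> B \<longleftrightarrow> s_minus = Plus) \<and> (1 \<in> B \<longleftrightarrow> s_plus = Plus)}"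
    assume "countable (divergence_set s_minus s_plus \<alpha> \<phi>)"
    moreover have "(\<lambda>B. to_circle (x B)) ` ?S \<subseteq> divergence_set s_minus s_plus \<alpha> \<phi>"
      unfolding divergence_set_def using sign [OF minus] sign [OF plus] by auto
    ultimately have "countable ((\<lambda>B. to_circle (x B)) ` ?S)" by (rule countable_subset [rotated])
    then have "countable ?S" by (rule countable_image_inj_on) (rule inj_on_subset [OF inj subset_UNIV])
    then show False using uncountable_sets_with_prescribed_01 by blast
  qed
  with \<phi> show ?thesis by blast
qed

end
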